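(* Let $E=\mathrm{End}(\mathbb{Q},\le)$ and $G=\mathrm{Aut}(\mathbb{Q},\le)$. If $\xi\colon E\to E$ is a monoid automorphism such that $\xi(g)=g$ for all $g\in G$, then $\xi$ is the identity map on $E$.
   Context: $\mathrm{End}(\mathbb{Q},\le)$ is the monoid, under composition, of all maps $f\colon\mathbb{Q}\to\mathbb{Q}$ with $x\le y\Rightarrow f(x)\le f(y)$; $\mathrm{Aut}(\mathbb{Q},\le)$ is the group of order-automorphisms of $\mathbb{Q}$. *)

theory Defs
  imports Complex_Main "HOL-Algebra.Group"
begin

definition End_Q :: "(rat \<Rightarrow> rat) monoid" where
  "End_Q = \<lparr>carrier = {f. mono f}, mult = (\<circ>), one = id\<rparr>"

definition Aut_Q :: "(rat \<Rightarrow> rat) monoid" where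
  "Aut_Q = \<lparr>carrier = {g. bij g \<and> (\<forall>x y. g x \<le> g y \<longleftrightarrow> x \<le> y)}, mult = (\<circ>), one = id\<rparr>"

lemma monoid_End_Q: "monoid End_Q"
  by (rule monoidI) (auto simp: End_Q_def mono_def)

lemma group_Aut_Q: "group Aut_Q"
proof (rule groupI)
  fix g assume "g \<in> carrier Aut_Q"
  then have b: "bij g" and o: "\<And>x y. g x \<le> g y \<longleftrightarrow> x \<le> y"
    by (auto simp: Aut_Q_def)
  have "inv_into UNIV g x \<le> inv_into UNIV g y \<longleftrightarrow> x \<le> y" for x y
    using o[of "inv_into UNIV g x" "inv_into UNIV g y"] b
    by (simp add: bij_is_surj surj_f_inv_f)
  then have "inv_into UNIV g \<in> carrier Aut_Q"
    using b by (simp add: Aut_Q_def bij_imp_bij_inv)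
  moreover have "inv_into UNIV g \<otimes>\<^bsub>Aut_Q\<^esub> g = \<one>\<^bsub>Aut_Q\<^esub>"
    using b by (simp add: Aut_Q_def bij_is_inj)
  ultimately show "\<exists>h\<in>carrier Aut_Q. h \<otimes>\<^bsub>Aut_Q\<^esub> g = \<one>\<^bsub>Aut_Q\<^esub>"
    by blast
qed (auto simp: Aut_Q_def intro: bij_comp)

lemma Aut_Q_subset_End_Q: "carrier Aut_Q \<subseteq> carrier End_Q"
  by (auto simp: Aut_Q_def End_Q_def mono_def)

text \<open>\<^const>\<open>iso\<close> consists of the bijective multiplicative maps; preservation of the unit
  is not part of \<^const>\<open>hom\<close> and is added here.\<close>

definition monoid_automorphism :: "('a, 'b) monoid_scheme \<Rightarrow> ('a \<Rightarrow> 'a) \<Rightarrow> bool" where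
  "monoid_automorphism M \<xi> \<longleftrightarrow> \<xi> \<in> iso M M \<and> \<xi> \<one>\<^bsub>M\<^esub> = \<one>\<^bsub>M\<^esub>"

end

theory Submission
  imports Defs
begin

text \<open>An endomorphism is determined by how it multiplies constant maps:
  \<open>f \<circ> c\<^sub>q = c\<^bsub>f q\<^esub>\<close>, where \<open>c\<^sub>q\<close> is the constant map with value \<open>q\<close>. So it suffices that
  \<open>\<xi>\<close> fixes every constant map. The constant maps are the left zeros of the monoid, a
  property stated purely in terms of composition, so \<open>\<xi>\<close> sends \<open>c\<^sub>q\<close> to some \<open>c\<^sub>p\<close>. Every
  automorphism of \<open>(\<rat>, \<le>)\<close> that fixes \<open>q\<close> satisfies \<open>g \<circ> c\<^sub>q = c\<^sub>q\<close>, and applying \<open>\<xi>\<close>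
  shows that it fixes \<open>p\<close> as well. The dilation by the factor \<open>2\<close> about \<open>q\<close> has \<open>q\<close> as
  its only fixed point, whence \<open>p = q\<close>.\<close>

lemma const_in_End_Q: "(\<lambda>_. q) \<in> carrier End_Q"
  by (simp add: End_Q_def mono_def)

lemma dilation_in_Aut_Q: "(\<lambda>x. 2 * x - q) \<in> carrier Aut_Q"
proof -
  have "bij (\<lambda>x::rat. 2 * x - q)"
    by (rule o_bij[where g = "\<lambda>y. (y + q) / 2"]) (auto simp: fun_eq_iff field_simps)
  then show ?thesis
    by (simp add: Aut_Q_def)
qed

text \<open>Surjectivity is what transports the left zero property: it lets the constant map \<open>\<lambda>_. 0\<close>,
  like any other endomorphism, be written as \<open>\<xi> h\<close>.\<close>

lemma iso_End_Q_const:
  assumes "\<xi> \<in> iso End_Q End_Q"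
  obtains p where "\<xi> (\<lambda>_. q) = (\<lambda>_. p)"
proof -
  have "(\<lambda>_. 0) \<in> \<xi> ` carrier End_Q"
    using assms const_in_End_Q by (simp add: iso_def bij_betw_def)
  then obtain h where h: "h \<in> carrier End_Q" "\<xi> h = (\<lambda>_. 0)"
    by force
  have "\<xi> (\<lambda>_. q) = \<xi> ((\<lambda>_. q) \<circ> h)"
    by (simp add: comp_def)
  also have "\<dots> = \<xi> (\<lambda>_. q) \<circ> \<xi> h"
    using assms h(1) const_in_End_Q[of q] by (auto simp: iso_def hom_def End_Q_def)
  also have "\<dots> = (\<lambda>_. \<xi> (\<lambda>_. q) 0)"
    by (simp add: h(2) comp_def)
  finally show thesis
    by (rule that)
qed

theorem corollary3p4:
  fixes \<xi> :: "(rat \<Rightarrow> rat) \<Rightarrow> (rat \<Rightarrow> rat)"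
  assumes "monoid_automorphism End_Q \<xi>"
    and "\<And>g. g \<in> carrier Aut_Q \<Longrightarrow> \<xi> g = g"
  shows "\<forall>f \<in> carrier End_Q. \<xi> f = f"
proof
  have iso: "\<xi> \<in> iso End_Q End_Q"
    using assms(1) by (simp add: monoid_automorphism_def)
  have mult: "\<xi> (f \<circ> g) = \<xi> f \<circ> \<xi> g" if "f \<in> carrier End_Q" "g \<in> carrier End_Q" for f g
    using iso that by (auto simp: iso_def hom_def End_Q_def)
  have const: "\<xi> (\<lambda>_. q) = (\<lambda>_. q)" for q
  proof -
    obtain p where p: "\<xi> (\<lambda>_. q) = (\<lambda>_. p)"
      using iso by (rule iso_End_Q_const)
    define d :: "rat \<Rightarrow> rat" where "d = (\<lambda>x. 2 * x - q)"
    have d: "d \<in> carrier Aut_Q"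
      unfolding d_def by (rule dilation_in_Aut_Q)
    have "(\<lambda>_. p) = \<xi> (d \<circ> (\<lambda>_. q))"
      using p by (simp add: d_def comp_def)
    also have "\<dots> = d \<circ> (\<lambda>_. p)"
      using mult[of d "\<lambda>_. q"] d Aut_Q_subset_End_Q const_in_End_Q assms(2) p by auto
    finally have "p = d p"
      by (simp add: fun_eq_iff)
    then show ?thesis
      using p by (simp add: d_def)
  qed
  fix f assume f: "f \<in> carrier End_Q"
  show "\<xi> f = f"
  proof
    fix q
    have "(\<lambda>_. f q) = \<xi> (f \<circ> (\<lambda>_. q))"
      using const[of "f q"] by (simp add: comp_def)
    also have "\<dots> = \<xi> f \<circ> (\<lambda>_. q)"
      using mult[OF f const_in_End_Q] const by simp
    finally show "\<xi> f q = f q"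
      by (simp add: fun_eq_iff)
  qed
qed

end
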